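(* Let $j$ be a positive integer. For every positive integer $n$, $\overline{p}_{1,j}(n)=\sum_{m\geq j}M(m,n)$, i.e. $\overline{p}_{1,j}(n)$ equals the number of partitions of $n$ with crank $\geq j$.
   Context: A partition of $n$ is a finite multiset of positive integers summing to $n$. The crank of a partition is its largest part if $1$ is not a part, and otherwise it is (the number of parts larger than the number of ones) minus (the number of ones). $M(m,n)$ denotes the number of partitions of $n$ with crank $m$, except that for $n=1$ one uses the standard convention $M(-1,1)=M(1,1)=1$, $M(0,1)=-1$ and $M(m,1)=0$ otherwise (so that $\sum_{n\ge0}M(m,n)q^n=\frac{1}{(q;q)_\infty}\sum_{k\geq1}(-1)^{k-1}q^{k(k-1)/2+k|m|}(1-q^k)$); "number of partitions of $n$ with crank $\geq j$" means $\sum_{m\ge j}M(m,n)$. For positive integers $A,a$ and a partition $\pi$, $\mathrm{mex}_{A,a}(\pi)$ is the smallest element of $\{a,a+A,a+2A,\dots\}$ that is not a part of $\pi$. $\overline{p}_{A,a}(n)$ is the number of partitions $\pi$ of $n$ with $\mathrm{mex}_{A,a}(\pi)\equiv A+a \pmod{2A}$. *)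

theory Defs
  imports "HOL-Library.Multiset" "HOL-Number_Theory.Cong"
begin

definition partitions_of :: "nat \<Rightarrow> nat multiset set" where
  "partitions_of n = {p. 0 \<notin># p \<and> sum_mset p = n}"

lemma finite_partitions_of: "finite (partitions_of n)"
proof (rule finite_subset)
  show "partitions_of n \<subseteq> mset ` {xs. set xs \<subseteq> {..n} \<and> length xs \<le> n}"
  proof
    fix p assume p: "p \<in> partitions_of n"
    have size_le: "0 \<notin># q \<Longrightarrow> size q \<le> sum_mset q" for q :: "nat multiset"
      by (induction q) auto
    obtain xs where xs: "p = mset xs" by (metis ex_mset)
    have "set xs \<subseteq> {..n}"
      using p member_le_sum_list[of _ xs]
      by (auto simp: partitions_of_def xs sum_mset_sum_list)
    moreover have "length xs \<le> n"
      using p size_le[of p] by (simp add: partitions_of_def xs)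
    ultimately show "p \<in> mset ` {xs. set xs \<subseteq> {..n} \<and> length xs \<le> n}"
      using xs by blast
  qed
  show "finite (mset ` {xs. set xs \<subseteq> {..n} \<and> length xs \<le> n})"
    by (intro finite_imageI finite_lists_length_le) simp
qed

text \<open>The inserted \<open>0\<close> only matters for the empty partition, whose crank is \<open>0\<close>.\<close>

definition crank :: "nat multiset \<Rightarrow> int" where
  "crank p =
    (if 1 \<notin># p then int (Max (insert 0 (set_mset p)))
     else int (size {#x \<in># p. count p 1 < x#}) - int (count p 1))"

text \<open>
  \<open>crank_count m n\<close> is $M(m,n)$. The values for \<open>n = 1\<close> follow the standard convention
  and are not those of the actual partition count.
\<close>

definition crank_count :: "int \<Rightarrow> nat \<Rightarrow> int" where
  "crank_count m n =
    (if n = 1 then (if m = 0 then - 1 else if m = 1 \<or> m = - 1 then 1 else 0)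
     else int (card {p \<in> partitions_of n. crank p = m}))"

text \<open>
  Only finitely many cranks occur for a given \<open>n\<close>, so a sum of $M(m,n)$ over infinitely many
  \<open>m\<close> can be taken as the sum over those \<open>m\<close> with $M(m,n) \neq 0$.
\<close>

lemma finite_crank_count_support: "finite {m. crank_count m n \<noteq> 0}"
proof (rule finite_subset)
  show "{m. crank_count m n \<noteq> 0} \<subseteq> {- 1, 0, 1} \<union> crank ` partitions_of n"
    by (auto simp: crank_count_def card_eq_0_iff split: if_splits)
  show "finite ({- 1, 0, 1} \<union> crank ` partitions_of n)"
    by (simp add: finite_partitions_of)
qed

definition mex :: "nat \<Rightarrow> nat \<Rightarrow> nat multiset \<Rightarrow> nat" where
  "mex A a p = (LEAST x. (\<exists>k. x = a + k * A) \<and> x \<notin># p)"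

definition pbar :: "nat \<Rightarrow> nat \<Rightarrow> nat \<Rightarrow> nat" where
  "pbar A a n = card {p \<in> partitions_of n. [mex A a p = A + a] (mod (2 * A))}"

end

theory Submission
  imports Defs "HOL-Computational_Algebra.Formal_Power_Series"
begin

text \<open>
  Write $P = 1/(q;q)_\infty$ and let $C_j$ and $B_j$ be the generating functions of the numbers of
  partitions with crank at least $j$ and with $\mathrm{mex}_{1,j} \equiv j + 1 \pmod 2$. Both
  satisfy $F_j + q^j F_{j+1} = q^j P$ for $j \ge 1$, and this recurrence determines the coefficients.

  For the mex, remove one part $j$ from a partition that contains $j$; if its
  $\mathrm{mex}_{1,j}$ has the wrong parity, then what remains is counted by $B_{j+1}$.

  For the crank, a partition with $\omega > 0$ ones has crank at least $j$ iff it has at least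
  $\omega + j$ parts greater than $\omega$, that is, iff $\omega < D$, where $D$ is the largest width
  of a rectangle with $D + j - 1$ rows in its Young diagram. Summing over $D$ and treating the
  partitions without ones separately gives
  $C_j = \sum_{D\ge1} q^{D(D+j-1)} / ((q)_{D-1} (q)_{D+j-1})$. The recurrence then becomes
  Durfee's identity $P = \sum_{e\ge0} q^{e(e+j)} / ((q)_e (q)_{e+j})$.
\<close>

unbundle fps_syntax

section \<open>Generating functions of predicates on partitions\<close>

text \<open>The coefficients are integers, so that identities can be subtracted and factors 1 - q^k
  cancelled.\<close>

definition gf :: "(nat multiset \<Rightarrow> bool) \<Rightarrow> int fps" where
  "gf P = Abs_fps (\<lambda>n. int (card {p \<in> partitions_of n. P p}))"

lemma gf_nth: "gf P $ n = int (card {p \<in> partitions_of n. P p})"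
  by (simp add: gf_def)

lemma gf_cong:
  assumes "\<And>p. 0 \<notin># p \<Longrightarrow> P p \<longleftrightarrow> Q p"
  shows "gf P = gf Q"
proof -
  have "{p \<in> partitions_of n. P p} = {p \<in> partitions_of n. Q p}" for n
    using assms by (auto simp: partitions_of_def)
  then show ?thesis by (simp add: gf_def)
qed

lemma gf_split: "gf P = gf (\<lambda>p. P p \<and> Q p) + gf (\<lambda>p. P p \<and> \<not> Q p)"
proof (rule fps_ext)
  fix n
  let ?A = "{p \<in> partitions_of n. P p \<and> Q p}" and ?B = "{p \<in> partitions_of n. P p \<and> \<not> Q p}"
  have "card (?A \<union> ?B) = card ?A + card ?B"
    by (rule card_Un_disjoint) (auto simp: finite_partitions_of)
  moreover have "?A \<union> ?B = {p \<in> partitions_of n. P p}" by blast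
  ultimately show "gf P $ n = (gf (\<lambda>p. P p \<and> Q p) + gf (\<lambda>p. P p \<and> \<not> Q p)) $ n"
    by (simp add: gf_nth)
qed

text \<open>One bijection between all partitions with \<open>P\<close> and all with \<open>Q\<close>
  serves every size at once: as it lowers sizes by exactly \<open>k\<close>, it restricts to a
  bijection from size \<open>n\<close> to size \<open>n - k\<close>. For \<open>n < k\<close> no
  partition satisfies \<open>P\<close>.\<close>

lemma gf_shift:
  assumes bij: "bij_betw f {p. 0 \<notin># p \<and> P p} {p. 0 \<notin># p \<and> Q p}"
    and wt: "\<And>p. 0 \<notin># p \<Longrightarrow> P p \<Longrightarrow> sum_mset p = k + sum_mset (f p)"
  shows "gf P = fps_X ^ k * gf Q"
proof (rule fps_ext)
  fix n
  show "gf P $ n = (fps_X ^ k * gf Q) $ n"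
  proof (cases "n < k")
    case True
    then have "{p \<in> partitions_of n. P p} = {}"
      using wt by (fastforce simp: partitions_of_def)
    with True show ?thesis
      by (simp only: gf_nth fps_X_power_mult_nth card.empty of_nat_0 if_True)
  next
    case False
    have "bij_betw f {p \<in> partitions_of n. P p} {p \<in> partitions_of (n - k). Q p}"
    proof (rule bij_betw_subset[OF bij])
      show "{p \<in> partitions_of n. P p} \<subseteq> {p. 0 \<notin># p \<and> P p}"
        by (auto simp: partitions_of_def)
      show "f ` {p \<in> partitions_of n. P p} = {p \<in> partitions_of (n - k). Q p}"
      proof (intro equalityI subsetI)
        fix q assume "q \<in> f ` {p \<in> partitions_of n. P p}"
        then obtain p where p: "p \<in> partitions_of n" "P p" "q = f p" by blast
        then show "q \<in> {p \<in> partitions_of (n - k). Q p}"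
          using bij_betwE[OF bij] wt[of p] by (auto simp: partitions_of_def)
      next
        fix q assume q: "q \<in> {p \<in> partitions_of (n - k). Q p}"
        then obtain p where p: "0 \<notin># p" "P p" "q = f p"
          using bij_betw_imp_surj_on[OF bij] by (auto simp: partitions_of_def)
        then have "sum_mset p = n"
          using wt[of p] q False by (auto simp: partitions_of_def)
        then show "q \<in> f ` {p \<in> partitions_of n. P p}"
          using p by (auto simp: partitions_of_def)
      qed
    qed
    from bij_betw_same_card[OF this] show ?thesis
      using False by (simp add: gf_nth fps_X_power_mult_nth)
  qed
qed

text \<open>Sorting the pairs by the size \<open>i\<close> of their first component gives the Cauchy
  product.\<close>

lemma gf_prod:
  assumes bij: "bij_betw f {p. 0 \<notin># p \<and> P p} ({p. 0 \<notin># p \<and> A p} \<times> {p. 0 \<notin># p \<and> B p})"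
    and wt: "\<And>p. 0 \<notin># p \<Longrightarrow> P p \<Longrightarrow> sum_mset p = k + sum_mset (fst (f p)) + sum_mset (snd (f p))"
  shows "gf P = fps_X ^ k * (gf A * gf B)"
proof (rule fps_ext)
  fix n
  show "gf P $ n = (fps_X ^ k * (gf A * gf B)) $ n"
  proof (cases "n < k")
    case True
    then have "{p \<in> partitions_of n. P p} = {}"
      using wt by (fastforce simp: partitions_of_def)
    with True show ?thesis
      by (simp only: gf_nth fps_X_power_mult_nth card.empty of_nat_0 if_True)
  next
    case False
    let ?F = "\<lambda>i. {p \<in> partitions_of i. A p} \<times> {p \<in> partitions_of (n - k - i). B p}"
    have "bij_betw f {p \<in> partitions_of n. P p} (\<Union>i\<le>n - k. ?F i)"
    proof (rule bij_betw_subset[OF bij])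
      show "{p \<in> partitions_of n. P p} \<subseteq> {p. 0 \<notin># p \<and> P p}"
        by (auto simp: partitions_of_def)
      show "f ` {p \<in> partitions_of n. P p} = (\<Union>i\<le>n - k. ?F i)"
      proof (intro equalityI subsetI)
        fix q assume "q \<in> f ` {p \<in> partitions_of n. P p}"
        then obtain p where p: "p \<in> partitions_of n" "P p" "q = f p" by blast
        then have "f p \<in> {p. 0 \<notin># p \<and> A p} \<times> {p. 0 \<notin># p \<and> B p}"
          using bij_betwE[OF bij] by (auto simp: partitions_of_def)
        moreover have "sum_mset (fst q) \<le> n - k" "sum_mset (snd q) = n - k - sum_mset (fst q)"
          using p wt[of p] by (auto simp: partitions_of_def)
        ultimately show "q \<in> (\<Union>i\<le>n - k. ?F i)"
          using p by (auto simp: partitions_of_def intro!: bexI[of _ "sum_mset (fst q)"])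
      next
        fix q assume "q \<in> (\<Union>i\<le>n - k. ?F i)"
        then obtain i where i: "i \<le> n - k" "q \<in> ?F i" by blast
        then have "q \<in> {p. 0 \<notin># p \<and> A p} \<times> {p. 0 \<notin># p \<and> B p}"
          by (auto simp: partitions_of_def)
        then obtain p where p: "0 \<notin># p" "P p" "q = f p"
          unfolding bij_betw_imp_surj_on[OF bij, symmetric] by blast
        then have "sum_mset p = n"
          using wt[of p] i False by (auto simp: partitions_of_def)
        then show "q \<in> f ` {p \<in> partitions_of n. P p}"
          using p by (auto simp: partitions_of_def)
      qed
    qed
    from bij_betw_same_card[OF this]
    have "card {p \<in> partitions_of n. P p} = card (\<Union>i\<le>n - k. ?F i)" .
    also have "\<dots> = (\<Sum>i\<le>n - k. card (?F i))"
      by (rule card_UN_disjoint) (auto simp: finite_partitions_of, auto simp: partitions_of_def)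
    finally have "int (card {p \<in> partitions_of n. P p}) = (gf A * gf B) $ (n - k)"
      by (simp add: gf_nth fps_mult_nth card_cartesian_product atLeast0AtMost)
    then show ?thesis using False by (simp add: gf_nth fps_X_power_mult_nth)
  qed
qed

text \<open>Removing \<open>c\<close> copies of \<open>k\<close> is inverted by adding them back.
  This serves for dropping a largest part, ones, or the part \<open>j\<close> in the mex
  recurrence.\<close>

lemma gf_remove:
  fixes k c :: nat
  assumes k: "k > 0" and QP: "\<And>p. 0 \<notin># p \<Longrightarrow> Q (p + replicate_mset c k) \<longleftrightarrow> P p"
  shows "gf (\<lambda>p. c \<le> count p k \<and> Q p) = fps_X ^ (c * k) * gf P"
proof (rule gf_shift)
  have sub: "c \<le> count p k \<Longrightarrow> p - replicate_mset c k + replicate_mset c k = p" for p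
    by (simp add: count_le_replicate_mset_subset_eq subset_mset.diff_add)
  show "bij_betw (\<lambda>p. p - replicate_mset c k) {p. 0 \<notin># p \<and> c \<le> count p k \<and> Q p} {p. 0 \<notin># p \<and> P p}"
  proof (rule bij_betwI[where g = "\<lambda>p. p + replicate_mset c k"])
    show "(\<lambda>p. p - replicate_mset c k) \<in> {p. 0 \<notin># p \<and> c \<le> count p k \<and> Q p} \<rightarrow> {p. 0 \<notin># p \<and> P p}"
    proof
      fix p assume "p \<in> {p. 0 \<notin># p \<and> c \<le> count p k \<and> Q p}"
      moreover from this have "0 \<notin># p - replicate_mset c k" by (auto dest: in_diffD)
      ultimately show "p - replicate_mset c k \<in> {p. 0 \<notin># p \<and> P p}"
        using QP[of "p - replicate_mset c k"] sub[of p] by auto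
    qed
  qed (use k QP sub in \<open>auto simp: in_replicate_mset\<close>)
  fix p assume "c \<le> count p k \<and> Q p"
  then have "sum_mset p = sum_mset (p - replicate_mset c k + replicate_mset c k)"
    using sub by simp
  then show "sum_mset p = c * k + sum_mset (p - replicate_mset c k)"
    by (simp del: diff_union_cancelR)
qed

section \<open>Partitions with bounded parts and with bounded length\<close>

abbreviation gf_le :: "nat \<Rightarrow> int fps" where
  "gf_le k \<equiv> gf (\<lambda>p. \<forall>x\<in>#p. x \<le> k)"

abbreviation gf_size :: "nat \<Rightarrow> int fps" where
  "gf_size k \<equiv> gf (\<lambda>p. size p \<le> k)"

lemma gf_empty: "gf (\<lambda>p. p = {#}) = 1"
proof (rule fps_ext)
  fix n
  have "{p \<in> partitions_of n. p = {#}} = (if n = 0 then {{#}} else {})"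
    by (auto simp: partitions_of_def)
  then show "gf (\<lambda>p. p = {#}) $ n = 1 $ n" by (simp add: gf_nth)
qed

lemma gf_le_0: "gf_le 0 = 1"
proof -
  have "0 \<notin># p \<Longrightarrow> (\<forall>x\<in>#p. x \<le> 0) \<longleftrightarrow> p = {#}" for p :: "nat multiset"
    by (cases p) auto
  then have "gf_le 0 = gf (\<lambda>p. p = {#})" by (rule gf_cong)
  then show ?thesis by (simp add: gf_empty)
qed

text \<open>Either no part equals \<open>Suc k\<close>, or one copy of it can be removed.\<close>

lemma gf_le_Suc: "gf_le (Suc k) = gf_le k + fps_X ^ Suc k * gf_le (Suc k)"
proof -
  let ?Q = "\<lambda>p. \<forall>x\<in>#p. x \<le> Suc k"
  have "gf_le (Suc k) = gf (\<lambda>p. ?Q p \<and> 1 \<le> count p (Suc k)) + gf (\<lambda>p. ?Q p \<and> \<not> 1 \<le> count p (Suc k))"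
    by (rule gf_split)
  moreover have "gf (\<lambda>p. ?Q p \<and> \<not> 1 \<le> count p (Suc k)) = gf_le k"
  proof (rule gf_cong)
    fix p
    show "?Q p \<and> \<not> 1 \<le> count p (Suc k) \<longleftrightarrow> (\<forall>x\<in>#p. x \<le> k)"
      by (auto simp: le_Suc_eq not_le count_eq_zero_iff)
  qed
  moreover have "gf (\<lambda>p. 1 \<le> count p (Suc k) \<and> ?Q p) = fps_X ^ (1 * Suc k) * gf_le (Suc k)"
    by (rule gf_remove) (auto simp: in_replicate_mset)
  ultimately show ?thesis by (simp add: conj_commute)
qed

lemma filter_mset_all: "(\<And>x. x \<in># M \<Longrightarrow> P x) \<Longrightarrow> filter_mset P M = M"
  by (simp add: filter_mset_eq_conv)

lemma filter_mset_none: "(\<And>x. x \<in># M \<Longrightarrow> \<not> P x) \<Longrightarrow> filter_mset P M = {#}"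
  by (simp add: filter_mset_eq_conv)

text \<open>From a partition with exactly \<open>Suc k\<close> parts, the first column of its Young
  diagram can be removed.\<close>

lemma gf_size_Suc: "gf_size (Suc k) = gf_size k + fps_X ^ Suc k * gf_size (Suc k)"
proof -
  have "gf_size (Suc k) = gf (\<lambda>p. size p \<le> Suc k \<and> size p \<le> k) + gf (\<lambda>p. size p \<le> Suc k \<and> \<not> size p \<le> k)"
    by (rule gf_split)
  moreover have "gf (\<lambda>p. size p \<le> Suc k \<and> size p \<le> k) = gf_size k"
    by (rule gf_cong) auto
  moreover have "gf (\<lambda>p. size p \<le> Suc k \<and> \<not> size p \<le> k) = fps_X ^ Suc k * gf_size (Suc k)"
  proof (rule gf_shift)
    \<comment> \<open>The ones would become zeros and are dropped; \<open>?g\<close> restores them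
      as the parts missing from a total of \<open>Suc k\<close>.\<close>
    let ?f = "\<lambda>p. image_mset (\<lambda>x::nat. x - 1) (filter_mset (\<lambda>x. 1 < x) p)"
    let ?g = "\<lambda>p. image_mset Suc p + replicate_mset (Suc k - size p) (1::nat)"
    have dec: "p = image_mset Suc (?f p) + replicate_mset (count p 1) 1" if "0 \<notin># p" for p :: "nat multiset"
    proof -
      have "image_mset Suc (?f p) = image_mset (\<lambda>x. x) (filter_mset (\<lambda>x. 1 < x) p)"
        unfolding image_mset.compositionality by (rule image_mset_cong) auto
      moreover have "replicate_mset (count p 1) 1 = filter_mset (\<lambda>x. \<not> 1 < x) p"
        using that by (auto simp: multiset_eq_iff not_less le_Suc_eq count_eq_zero_iff)
      ultimately show ?thesis
        by (simp only: multiset.map_ident multiset_partition[symmetric])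
    qed
    have dec_size: "size p = size (?f p) + count p 1" if "0 \<notin># p" for p :: "nat multiset"
      using arg_cong[OF dec[OF that], of size] by simp
    show "bij_betw ?f {p. 0 \<notin># p \<and> size p \<le> Suc k \<and> \<not> size p \<le> k} {p. 0 \<notin># p \<and> size p \<le> Suc k}"
    proof (rule bij_betwI[where g = ?g])
      show "?f \<in> {p. 0 \<notin># p \<and> size p \<le> Suc k \<and> \<not> size p \<le> k} \<rightarrow> {p. 0 \<notin># p \<and> size p \<le> Suc k}"
      proof
        fix p :: "nat multiset" assume p: "p \<in> {p. 0 \<notin># p \<and> size p \<le> Suc k \<and> \<not> size p \<le> k}"
        then have "size (?f p) \<le> Suc k" using dec_size[of p] by simp
        then show "?f p \<in> {p. 0 \<notin># p \<and> size p \<le> Suc k}" by auto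
      qed
      show "?g \<in> {p. 0 \<notin># p \<and> size p \<le> Suc k} \<rightarrow> {p. 0 \<notin># p \<and> size p \<le> Suc k \<and> \<not> size p \<le> k}"
        by (auto simp: in_replicate_mset)
      show "?g (?f p) = p" if "p \<in> {p. 0 \<notin># p \<and> size p \<le> Suc k \<and> \<not> size p \<le> k}" for p
      proof -
        have "Suc k - size (?f p) = count p 1" using dec_size[of p] that by (elim CollectE conjE) linarith
        then have "?g (?f p) = image_mset Suc (?f p) + replicate_mset (count p 1) 1"
          by (simp only:)
        also have "\<dots> = p" by (rule dec[symmetric]) (use that in simp)
        finally show ?thesis .
      qed
      show "?f (?g p) = p" if p: "p \<in> {p. 0 \<notin># p \<and> size p \<le> Suc k}" for p
      proof -
        have "1 < Suc x" if "x \<in># p" for x using that p by (cases x) auto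
        then have "filter_mset (\<lambda>x. 1 < x) (image_mset Suc p) = image_mset Suc p"
          by (intro filter_mset_all) auto
        moreover have "filter_mset (\<lambda>x. 1 < x) (replicate_mset (Suc k - size p) (1::nat)) = {#}"
          by (rule filter_mset_none) (auto simp: in_replicate_mset split: if_splits)
        ultimately have "filter_mset (\<lambda>x. 1 < x) (?g p) = image_mset Suc p"
          by (simp only: filter_union_mset add_0_right)
        then show ?thesis by (simp add: image_mset.compositionality comp_def)
      qed
    qed
    have sum_Suc: "sum_mset (image_mset Suc q) = size q + sum_mset q" for q
      by (induction q) auto
    fix p :: "nat multiset"
    assume p: "0 \<notin># p" "size p \<le> Suc k \<and> \<not> size p \<le> k"
    have "sum_mset p = size (?f p) + sum_mset (?f p) + count p 1"
      using arg_cong[OF dec[OF p(1)], of sum_mset] sum_Suc[of "?f p"] by simp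
    then show "sum_mset p = Suc k + sum_mset (?f p)"
      using dec_size[OF p(1)] p by simp
  qed
  ultimately show ?thesis by simp
qed

lemma fps_solve_rec: "(1 - x) * f = g" if "f = g + x * f" for f g x :: "int fps"
  using that by (simp only: left_diff_distrib mult_1_left diff_eq_eq)

text \<open>Both sides satisfy the same recurrence with the same start, and the factor 1 - q^(k+1)
  can be cancelled because its constant term is not zero. This replaces conjugation of
  partitions.\<close>

lemma gf_size_eq: "gf_size k = gf_le k"
proof (induction k)
  case 0
  then show ?case by (simp only: le_zero_eq size_eq_0_iff_empty gf_empty gf_le_0[unfolded le_zero_eq])
next
  case (Suc k)
  from fps_solve_rec[OF gf_size_Suc[of k]] fps_solve_rec[OF gf_le_Suc[of k]] Suc
  have "(1 - fps_X ^ Suc k) * gf_size (Suc k) = (1 - fps_X ^ Suc k) * gf_le (Suc k)"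
    by (simp only:)
  moreover have "(1 - fps_X ^ Suc k :: int fps) $ 0 \<noteq> 0"
    by simp
  then have "(1 - fps_X ^ Suc k :: int fps) \<noteq> 0" by (metis fps_zero_nth)
  ultimately show ?case by (simp del: power_Suc)
qed


section \<open>Rectangles in Young diagrams\<close>

text \<open>For \<open>e > 0\<close> this is the part number \<open>e\<close> of the conjugate
  partition, the length of column \<open>e\<close> of the Young diagram.\<close>

definition num_ge :: "nat \<Rightarrow> nat multiset \<Rightarrow> nat" where
  "num_ge e p = size (filter_mset (\<lambda>x. e \<le> x) p)"

lemma num_ge_antimono: "d \<le> e \<Longrightarrow> num_ge e p \<le> num_ge d p"
  unfolding num_ge_def by (intro size_mset_mono mset_subset_eqI) auto

lemma sum_mset_image_add: "sum_mset (image_mset (\<lambda>x. x + e) q) = sum_mset q + size q * e"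
  for e :: nat
  by (induction q) auto

text \<open>
  Cutting a \<open>e\<close> by \<open>r\<close> rectangle out of the Young diagram leaves a partition with parts at most
  \<open>e\<close> and one with at most \<open>r\<close> parts. Here \<open>T\<close> is a side condition that only depends on the former.
\<close>

lemma gf_durfee:
  fixes e r :: nat
  assumes e: "e > 0"
    and T: "\<And>\<alpha> \<beta> m. 0 \<notin># \<alpha> \<Longrightarrow> 0 \<notin># \<beta> \<Longrightarrow>
      T (\<alpha> + replicate_mset m e + image_mset (\<lambda>x. x + e) \<beta>) \<longleftrightarrow> T \<alpha>"
  shows "gf (\<lambda>p. r \<le> num_ge e p \<and> num_ge (Suc e) p \<le> r \<and> T p) =
    fps_X ^ (e * r) * (gf (\<lambda>p. (\<forall>x\<in>#p. x \<le> e) \<and> T p) * gf_size r)"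
proof -
  define lo :: "nat multiset \<Rightarrow> nat multiset" where "lo = filter_mset (\<lambda>x. x < e)"
  define hi :: "nat multiset \<Rightarrow> nat multiset"
    where "hi = (\<lambda>p. image_mset (\<lambda>x. x - e) (filter_mset (\<lambda>x. e < x) p))"
  \<comment> \<open>The rectangle takes up \<open>r\<close> of the \<open>num_ge e p\<close> parts
    that are at least \<open>e\<close>. The copies of \<open>e\<close> beyond these lie below it and
    go to the first component; the others are the rows of the rectangle that no part of \<beta>
    extends, which \<open>g\<close> counts as \<open>r - size \<beta>\<close>.\<close>
  define f where "f = (\<lambda>p. (lo p + replicate_mset (num_ge e p - r) e, hi p))"
  define g where "g = (\<lambda>(\<alpha>, \<beta>). \<alpha> + replicate_mset (r - size \<beta>) e + image_mset (\<lambda>x. x + e) \<beta>)"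
  let ?P = "\<lambda>p. r \<le> num_ge e p \<and> num_ge (Suc e) p \<le> r \<and> T p"
  let ?A = "\<lambda>p. (\<forall>x\<in>#p. x \<le> e) \<and> T p"
  have hi: "image_mset (\<lambda>x. x + e) (hi p) = filter_mset (\<lambda>x. e < x) p" for p
  proof -
    have "image_mset (\<lambda>x. x + e) (hi p) = image_mset (\<lambda>x. x) (filter_mset (\<lambda>x. e < x) p)"
      unfolding hi_def image_mset.compositionality by (rule image_mset_cong) auto
    then show ?thesis by (simp only: multiset.map_ident)
  qed
  have dec: "lo p + replicate_mset (count p e) e + image_mset (\<lambda>x. x + e) (hi p) = p" for p
    unfolding hi lo_def by (rule multiset_eqI) auto
  have hi0: "0 \<notin># hi p" and lo0: "0 \<notin># p \<Longrightarrow> 0 \<notin># lo p" for p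
    by (auto simp: hi_def lo_def)
  have num_Suc: "num_ge (Suc e) p = size (hi p)" for p
    by (simp add: num_ge_def hi_def Suc_le_eq)
  have num: "num_ge e p = count p e + size (hi p)" for p
  proof -
    have "filter_mset (\<lambda>x. e \<le> x) p = replicate_mset (count p e) e + filter_mset (\<lambda>x. e < x) p"
      by (rule multiset_eqI) auto
    then show ?thesis by (simp add: num_ge_def hi_def)
  qed
  have T_lo: "T p \<longleftrightarrow> T (lo p)" if "0 \<notin># p" for p
    using T[OF lo0[OF that] hi0[of p], of "count p e"] by (simp only: dec)
  have T_repl: "T (\<alpha> + replicate_mset m e) \<longleftrightarrow> T \<alpha>" if "0 \<notin># \<alpha>" for \<alpha> m
    using T[OF that, of "{#}" m] by simp
  show ?thesis
  proof (rule gf_prod[where f = f])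
    show "bij_betw f {p. 0 \<notin># p \<and> ?P p} ({p. 0 \<notin># p \<and> ?A p} \<times> {p. 0 \<notin># p \<and> size p \<le> r})"
    proof (rule bij_betwI[where g = g])
      show "f \<in> {p. 0 \<notin># p \<and> ?P p} \<rightarrow> {p. 0 \<notin># p \<and> ?A p} \<times> {p. 0 \<notin># p \<and> size p \<le> r}"
      proof
        fix p assume "p \<in> {p. 0 \<notin># p \<and> ?P p}"
        then have p: "0 \<notin># p" "?P p" by auto
        have "0 \<notin># lo p + replicate_mset (num_ge e p - r) e"
          using lo0[OF p(1)] e by (auto simp: in_replicate_mset)
        moreover have "\<forall>x\<in>#lo p + replicate_mset (num_ge e p - r) e. x \<le> e"
          by (auto simp: lo_def in_replicate_mset)
        moreover have "T (lo p + replicate_mset (num_ge e p - r) e)"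
          using p T_lo T_repl lo0 by blast
        ultimately show "f p \<in> {p. 0 \<notin># p \<and> ?A p} \<times> {p. 0 \<notin># p \<and> size p \<le> r}"
          using p hi0[of p] num_Suc[of p] by (auto simp: f_def)
      qed
      have g: "lo (g (\<alpha>, \<beta>)) = lo \<alpha>" "hi (g (\<alpha>, \<beta>)) = \<beta>"
          "count (g (\<alpha>, \<beta>)) e = count \<alpha> e + (r - size \<beta>)"
        if "0 \<notin># \<beta>" "\<forall>x\<in>#\<alpha>. x \<le> e" for \<alpha> \<beta> :: "nat multiset"
      proof -
        have "filter_mset (\<lambda>x. x < e) (image_mset (\<lambda>x. x + e) \<beta>) = {#}"
          "filter_mset (\<lambda>x. x < e) (replicate_mset (r - size \<beta>) e) = {#}"
          by (auto intro: filter_mset_none simp: in_replicate_mset)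
        then show "lo (g (\<alpha>, \<beta>)) = lo \<alpha>" by (simp add: lo_def g_def)
        have "filter_mset (\<lambda>x. e < x) (image_mset (\<lambda>x. x + e) \<beta>) = image_mset (\<lambda>x. x + e) \<beta>"
          using that by (intro filter_mset_all) (auto intro: gr0I)
        moreover have "filter_mset (\<lambda>x. e < x) \<alpha> = {#}"
          "filter_mset (\<lambda>x. e < x) (replicate_mset (r - size \<beta>) e) = {#}"
          using that by (auto intro!: filter_mset_none simp: in_replicate_mset not_less)
        ultimately show "hi (g (\<alpha>, \<beta>)) = \<beta>"
          by (simp add: hi_def g_def image_mset.compositionality comp_def)
        have "e \<notin># image_mset (\<lambda>x. x + e) \<beta>" using that by auto
        then have "count (image_mset (\<lambda>x. x + e) \<beta>) e = 0"
          by (simp only: count_eq_zero_iff not_False_eq_True)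
        then show "count (g (\<alpha>, \<beta>)) e = count \<alpha> e + (r - size \<beta>)"
          by (simp add: g_def)
      qed
      show "g \<in> {p. 0 \<notin># p \<and> ?A p} \<times> {p. 0 \<notin># p \<and> size p \<le> r} \<rightarrow> {p. 0 \<notin># p \<and> ?P p}"
      proof
        fix x :: "nat multiset \<times> nat multiset"
        assume "x \<in> {p. 0 \<notin># p \<and> ?A p} \<times> {p. 0 \<notin># p \<and> size p \<le> r}"
        then obtain \<alpha> \<beta> where x: "x = (\<alpha>, \<beta>)" "0 \<notin># \<alpha>" "\<forall>x\<in>#\<alpha>. x \<le> e" "T \<alpha>" "0 \<notin># \<beta>" "size \<beta> \<le> r"
          by auto
        have "0 \<notin># g (\<alpha>, \<beta>)" using x e by (auto simp: g_def in_replicate_mset)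
        moreover have "T (g (\<alpha>, \<beta>))" using T[OF x(2,5)] x(4) by (simp add: g_def)
        ultimately show "g x \<in> {p. 0 \<notin># p \<and> ?P p}"
          using g[OF x(5,3)] x(1,6) by (simp add: num num_Suc)
      qed
      show "g (f p) = p" if p: "p \<in> {p. 0 \<notin># p \<and> ?P p}" for p
      proof -
        \<comment> \<open>These bounds make both truncated subtractions below exact.\<close>
        have "r \<le> count p e + size (hi p)" "size (hi p) \<le> r"
          using p by (auto simp: num num_Suc)
        then have "num_ge e p - r + (r - size (hi p)) = count p e"
          unfolding num by linarith
        then have "replicate_mset (num_ge e p - r) e + replicate_mset (r - size (hi p)) e =
            replicate_mset (count p e) e"
          by (intro multiset_eqI) simp
        then have "lo p + (replicate_mset (num_ge e p - r) e + replicate_mset (r - size (hi p)) e) +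
            image_mset (\<lambda>x. x + e) (hi p) = p"
          using dec[of p] by (simp only:)
        then show ?thesis by (simp add: f_def g_def add.assoc)
      qed
      show "f (g x) = x" if x: "x \<in> {p. 0 \<notin># p \<and> ?A p} \<times> {p. 0 \<notin># p \<and> size p \<le> r}"
        for x :: "nat multiset \<times> nat multiset"
      proof -
        obtain \<alpha> \<beta> where ab: "x = (\<alpha>, \<beta>)" "\<forall>x\<in>#\<alpha>. x \<le> e" "0 \<notin># \<beta>" "size \<beta> \<le> r"
          using x by auto
        have "lo \<alpha> + replicate_mset (count \<alpha> e) e = \<alpha>"
          using ab(2) by (intro multiset_eqI) (auto simp: lo_def count_eq_zero_iff)
        then show ?thesis using g[OF ab(3,2)] ab by (simp add: f_def num)
      qed
    qed
    fix p assume p: "0 \<notin># p" "?P p"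
    \<comment> \<open>\<open>d\<close> is the number of copies of \<open>e\<close> below the
      rectangle; naming it eliminates the truncated subtraction in \<open>f\<close>.\<close>
    obtain d where d: "count p e + size (hi p) = r + d"
      using p by (metis num le_Suc_ex)
    have "sum_mset p = sum_mset (lo p) + count p e * e + (sum_mset (hi p) + size (hi p) * e)"
      using arg_cong[OF dec[of p], of sum_mset] sum_mset_image_add[of e "hi p"] by simp
    also have "\<dots> = sum_mset (lo p) + sum_mset (hi p) + (count p e + size (hi p)) * e"
      by (simp add: algebra_simps)
    also have "\<dots> = e * r + sum_mset (fst (f p)) + sum_mset (snd (f p))"
      unfolding d by (simp add: f_def num d algebra_simps)
    finally show "sum_mset p = e * r + sum_mset (fst (f p)) + sum_mset (snd (f p))" .
  qed
qed

text \<open>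
  \<open>contains_rect j e\<close> says that the first \<open>e + j\<close> parts are at least \<open>e\<close>. The case \<open>e = 0\<close> is
  separate because there are no zero parts to count.
\<close>

definition contains_rect :: "nat \<Rightarrow> nat \<Rightarrow> nat multiset \<Rightarrow> bool" where
  "contains_rect j e p \<longleftrightarrow> e = 0 \<or> e + j \<le> num_ge e p"

text \<open>The widths that fit are thus closed downwards, which allows partitions to be sorted by
  the largest one.\<close>

lemma contains_rect_antimono: "contains_rect j e p \<Longrightarrow> d \<le> e \<Longrightarrow> contains_rect j d p"
  using num_ge_antimono[of d e p] by (auto simp: contains_rect_def)

lemma num_ge_1: "0 \<notin># p \<Longrightarrow> num_ge 1 p = size p"
proof -
  assume p: "0 \<notin># p"
  have "1 \<le> x" if "x \<in># p" for x using that p by (cases x) auto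
  then show ?thesis unfolding num_ge_def by (subst filter_mset_all) auto
qed

text \<open>A rectangle of positive width \<open>e\<close> forces a part of at least
  \<open>e\<close>. Hence the remainders of the finite rectangle sums below do not affect low
  coefficients.\<close>

lemma gf_contains_rect_nth_eq_0:
  assumes "\<And>p. P p \<Longrightarrow> contains_rect j e p" and "n < e"
  shows "gf P $ n = 0"
proof -
  have "\<not> P p" if p: "p \<in> partitions_of n" for p
  proof
    assume "P p"
    then have "num_ge e p > 0" using assms by (fastforce simp: contains_rect_def)
    then obtain x where "x \<in># p" "e \<le> x"
      by (auto simp: num_ge_def nonempty_has_size[symmetric] filter_mset_eq_conv)
    moreover from this have "x \<le> sum_mset p" by (simp add: sum_mset.remove)
    ultimately show False using p assms(2) by (simp add: partitions_of_def)
  qed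
  then have "{p \<in> partitions_of n. P p} = {}" by blast
  then show ?thesis by (simp only: gf_nth card.empty of_nat_0)
qed

text \<open>Here \<open>e\<close> is the largest width, so at most \<open>e + j\<close> parts exceed
  \<open>e\<close>, and cutting out the rectangle with \<open>e + j\<close> rows leaves two
  independent partitions. For \<open>e = 0\<close> the condition says that there are at most
  \<open>j\<close> parts.\<close>

lemma gf_exact_rect:
  "gf (\<lambda>p. contains_rect j e p \<and> \<not> contains_rect j (Suc e) p) =
    fps_X ^ (e * (e + j)) * (gf_le e * gf_le (e + j))"
proof (cases "e = 0")
  case True
  have "gf (\<lambda>p. contains_rect j e p \<and> \<not> contains_rect j (Suc e) p) = gf_size j"
    by (rule gf_cong) (use True num_ge_1 in \<open>auto simp: contains_rect_def\<close>)
  then show ?thesis using True gf_le_0 by (simp add: gf_size_eq)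
next
  case False
  have "gf (\<lambda>p. contains_rect j e p \<and> \<not> contains_rect j (Suc e) p) =
      gf (\<lambda>p. e + j \<le> num_ge e p \<and> num_ge (Suc e) p \<le> e + j \<and> True)"
    by (rule gf_cong) (use False in \<open>auto simp: contains_rect_def\<close>)
  also have "\<dots> = fps_X ^ (e * (e + j)) * (gf (\<lambda>p. (\<forall>x\<in>#p. x \<le> e) \<and> True) * gf_size (e + j))"
    by (rule gf_durfee) (use False in auto)
  finally show ?thesis by (simp add: gf_size_eq)
qed

text \<open>
  Partitions with parts at most \<open>e\<close> and at least \<open>e\<close> ones are as numerous as those containing
  the part \<open>e\<close>: either way, a total of \<open>e\<close> can be taken away.
\<close>

lemma gf_le_few_ones:
  assumes "e > 0"
  shows "gf (\<lambda>p. (\<forall>x\<in>#p. x \<le> e) \<and> count p 1 < e) = gf_le (e - 1)"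
proof -
  let ?Q = "\<lambda>p. \<forall>x\<in>#p. x \<le> e"
  have "gf_le e = gf (\<lambda>p. ?Q p \<and> e \<le> count p 1) + gf (\<lambda>p. ?Q p \<and> \<not> e \<le> count p 1)"
    by (rule gf_split)
  moreover have "gf (\<lambda>p. e \<le> count p 1 \<and> ?Q p) = fps_X ^ (e * 1) * gf_le e"
    by (rule gf_remove) (use assms in \<open>auto simp: in_replicate_mset\<close>)
  moreover have "gf_le e = gf_le (e - 1) + fps_X ^ e * gf_le e"
    using gf_le_Suc[of "e - 1"] assms by (simp only: Suc_diff_1)
  ultimately show ?thesis by (simp add: conj_commute not_le)
qed

text \<open>For \<open>e \<ge> 2\<close> neither the rows of the rectangle nor the parts extending
  them are ones, so the bound on the ones concerns only the partition below the rectangle, where it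
  turns the bound \<open>e\<close> on the parts into \<open>e - 1\<close>.\<close>

lemma gf_exact_rect_few_ones:
  assumes "e \<ge> 2"
  shows "gf (\<lambda>p. contains_rect j e p \<and> \<not> contains_rect j (Suc e) p \<and> count p 1 < e) =
    fps_X ^ (e * (e + j)) * (gf_le (e - 1) * gf_le (e + j))"
proof -
  have "gf (\<lambda>p. contains_rect j e p \<and> \<not> contains_rect j (Suc e) p \<and> count p 1 < e) =
      gf (\<lambda>p. e + j \<le> num_ge e p \<and> num_ge (Suc e) p \<le> e + j \<and> count p 1 < e)"
    by (rule gf_cong) (use assms in \<open>auto simp: contains_rect_def\<close>)
  also have "\<dots> = fps_X ^ (e * (e + j)) *
      (gf (\<lambda>p. (\<forall>x\<in>#p. x \<le> e) \<and> count p 1 < e) * gf_size (e + j))"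
  proof (rule gf_durfee)
    fix \<alpha> \<beta> :: "nat multiset" and m
    assume "0 \<notin># \<beta>"
    have "1 \<notin># image_mset (\<lambda>x. x + e) \<beta>" using assms by auto
    then have "count (image_mset (\<lambda>x. x + e) \<beta>) 1 = 0"
      by (simp only: count_eq_zero_iff not_False_eq_True)
    then show "count (\<alpha> + replicate_mset m e + image_mset (\<lambda>x. x + e) \<beta>) 1 < e \<longleftrightarrow> count \<alpha> 1 < e"
      using assms by simp
  qed (use assms in simp)
  finally show ?thesis using gf_le_few_ones[of e] assms by (simp add: gf_size_eq)
qed

section \<open>Durfee's identity and its refinement by the number of ones\<close>

text \<open>Durfee's identity in finite form: partitions are sorted by their largest width, and
  those of width at least \<open>N\<close> are kept as a remainder.\<close>

lemma gf_True_eq_rect_sum: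
  "gf (\<lambda>p. True) = (\<Sum>e<N. fps_X ^ (e * (e + j)) * (gf_le e * gf_le (e + j))) + gf (contains_rect j N)"
proof (induction N)
  case 0
  show ?case by (simp add: contains_rect_def gf_cong[of "contains_rect j 0" "\<lambda>_. True"])
next
  case (Suc N)
  have "gf (contains_rect j N) =
      gf (\<lambda>p. contains_rect j N p \<and> contains_rect j (Suc N) p) +
      gf (\<lambda>p. contains_rect j N p \<and> \<not> contains_rect j (Suc N) p)"
    by (rule gf_split)
  moreover have "gf (\<lambda>p. contains_rect j N p \<and> contains_rect j (Suc N) p) = gf (contains_rect j (Suc N))"
    by (rule gf_cong) (use contains_rect_antimono in auto)
  ultimately show ?case using Suc by (simp add: gf_exact_rect)
qed

text \<open>The same sorting, started at width 2 because the dissection with few ones needs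
  \<open>e \<ge> 2\<close>; the partitions without ones are corrected for in
  \<open>gf_crank_eq\<close>.\<close>

lemma gf_rect_ones_sum:
  assumes "N \<ge> 2"
  shows "gf (\<lambda>p. contains_rect i 2 p \<and> contains_rect i (Suc (count p 1)) p) =
    (\<Sum>e=2..<N. fps_X ^ (e * (e + i)) * (gf_le (e - 1) * gf_le (e + i))) +
    gf (\<lambda>p. contains_rect i N p \<and> contains_rect i (Suc (count p 1)) p)"
  using assms
proof (induction N rule: dec_induct)
  case base
  show ?case by simp
next
  case (step N)
  let ?K = "\<lambda>N p. contains_rect i N p \<and> contains_rect i (Suc (count p 1)) p"
  have "gf (?K N) = gf (\<lambda>p. ?K N p \<and> contains_rect i (Suc N) p) +
      gf (\<lambda>p. ?K N p \<and> \<not> contains_rect i (Suc N) p)"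
    by (rule gf_split)
  moreover have "gf (\<lambda>p. ?K N p \<and> contains_rect i (Suc N) p) = gf (?K (Suc N))"
    by (rule gf_cong) (use contains_rect_antimono in auto)
  moreover have "gf (\<lambda>p. ?K N p \<and> \<not> contains_rect i (Suc N) p) =
      gf (\<lambda>p. contains_rect i N p \<and> \<not> contains_rect i (Suc N) p \<and> count p 1 < N)"
  proof (rule gf_cong)
    fix p
    \<comment> \<open>\<open>N\<close> is the largest width that fits, so the width
      \<open>Suc (count p 1)\<close> fits exactly if it is at most \<open>N\<close>.\<close>
    have "count p 1 < N \<longleftrightarrow> contains_rect i (Suc (count p 1)) p"
      if "contains_rect i N p" "\<not> contains_rect i (Suc N) p"
      using that contains_rect_antimono[of i N p "Suc (count p 1)"]
        contains_rect_antimono[of i "Suc (count p 1)" p "Suc N"] by force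
    then show "?K N p \<and> \<not> contains_rect i (Suc N) p \<longleftrightarrow>
        contains_rect i N p \<and> \<not> contains_rect i (Suc N) p \<and> count p 1 < N"
      by blast
  qed
  ultimately show ?case using step gf_exact_rect_few_ones[of N i] by (simp add: add.assoc)
qed

section \<open>The generating function of the crank\<close>

text \<open>With \<omega> > 0 ones, the bound asks for at least \<omega> + 1 + \<open>i\<close>
  parts of size at least \<omega> + 1, which is a rectangle of width \<omega> + 1 with offset
  \<open>i\<close>. Without ones it bounds the largest part.\<close>

lemma crank_ge_iff:
  "int (Suc i) \<le> crank p \<longleftrightarrow>
    (if count p 1 = 0 then \<not> (\<forall>x\<in>#p. x \<le> i) else contains_rect i (Suc (count p 1)) p)"
proof (cases "1 \<in># p")
  case True
  then have "crank p = int (num_ge (Suc (count p 1)) p) - int (count p 1)"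
    by (simp add: crank_def num_ge_def Suc_le_eq)
  moreover have "count p 1 \<noteq> 0" using True by (simp only: count_eq_zero_iff not_not)
  ultimately show ?thesis
    unfolding if_not_P[OF \<open>count p 1 \<noteq> 0\<close>] contains_rect_def by linarith
next
  case False
  then have "int (Suc i) \<le> crank p \<longleftrightarrow> Suc i \<le> Max (insert 0 (set_mset p))"
    by (simp add: crank_def del: of_nat_Suc)
  also have "\<dots> \<longleftrightarrow> (\<exists>x\<in>#p. Suc i \<le> x)"
    by (subst Max_ge_iff) auto
  also have "\<dots> \<longleftrightarrow> \<not> (\<forall>x\<in>#p. x \<le> i)"
    by (auto simp: not_le Suc_le_eq)
  finally show ?thesis using False by (simp add: count_eq_zero_iff)
qed

text \<open>
  The extra \<open>fps_X\<close> accounts for the convention $M(1,1) = 1$: the partition of \<open>1\<close> has crank \<open>-1\<close>.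
\<close>

definition gf_crank :: "nat \<Rightarrow> int fps" where
  "gf_crank i = gf (\<lambda>p. int (Suc i) \<le> crank p) + (if i = 0 then fps_X else 0)"

text \<open>Partitions with ones contribute equally to \<open>gf_crank i\<close> and to the first
  summand, since \<open>Suc (count p 1)\<close> is then at least 2. Among those without ones, the
  first summand counts the partitions with more than \<open>Suc i\<close> parts, the crank condition
  those with a part above \<open>i\<close>; the difference is computed by complements.\<close>

lemma gf_crank_eq:
  "gf_crank i = gf (\<lambda>p. contains_rect i 2 p \<and> contains_rect i (Suc (count p 1)) p) +
    fps_X ^ Suc i * gf_le (Suc i)"
proof -
  let ?z = "\<lambda>p::nat multiset. count p 1 = 0"
  let ?V = "\<lambda>p. contains_rect i (Suc (count p 1)) p"
  have crank: "gf (\<lambda>p. int (Suc i) \<le> crank p) =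
      gf (\<lambda>p. ?z p \<and> \<not> (\<forall>x\<in>#p. x \<le> i)) + gf (\<lambda>p. \<not> ?z p \<and> ?V p)"
    unfolding gf_split[of "\<lambda>p. int (Suc i) \<le> crank p" ?z]
    by (intro arg_cong2[of _ _ _ _ "(+)"] gf_cong) (auto simp only: crank_ge_iff split: if_splits)
  have K: "gf (\<lambda>p. contains_rect i 2 p \<and> ?V p) =
      gf (\<lambda>p. ?z p \<and> contains_rect i 2 p) + gf (\<lambda>p. \<not> ?z p \<and> ?V p)"
    unfolding gf_split[of "\<lambda>p. contains_rect i 2 p \<and> ?V p" ?z]
  proof (intro arg_cong2[of _ _ _ _ "(+)"] gf_cong)
    fix p
    show "(contains_rect i 2 p \<and> ?V p) \<and> ?z p \<longleftrightarrow> ?z p \<and> contains_rect i 2 p"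
      using contains_rect_antimono[of i 2 p 1] by auto
    show "(contains_rect i 2 p \<and> ?V p) \<and> \<not> ?z p \<longleftrightarrow> \<not> ?z p \<and> ?V p"
      using contains_rect_antimono[of i "Suc (count p 1)" p 2] by auto
  qed
  have z1: "gf ?z = gf (\<lambda>p. ?z p \<and> (\<forall>x\<in>#p. x \<le> i)) + gf (\<lambda>p. ?z p \<and> \<not> (\<forall>x\<in>#p. x \<le> i))"
    by (rule gf_split)
  have z2: "gf ?z = gf (\<lambda>p. ?z p \<and> contains_rect i 2 p) + gf (\<lambda>p. ?z p \<and> size p \<le> Suc i)"
    unfolding gf_split[of ?z "contains_rect i 2"]
  proof (intro arg_cong2[of _ _ _ _ "(+)"] gf_cong refl)
    fix p :: "nat multiset" assume 0: "0 \<notin># p"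
    have "num_ge 2 p = size p" if "?z p"
    proof -
      have "2 \<le> x" if "x \<in># p" for x
        using that 0 \<open>?z p\<close> by (cases "x = 0 \<or> x = 1") (auto simp: count_eq_zero_iff)
      then show ?thesis unfolding num_ge_def by (subst filter_mset_all) auto
    qed
    then show "?z p \<and> \<not> contains_rect i 2 p \<longleftrightarrow> ?z p \<and> size p \<le> Suc i"
      by (auto simp: contains_rect_def)
  qed
  have not_z: "\<not> ?z p \<longleftrightarrow> 1 \<le> count p 1" for p by auto
  have s: "gf_size (Suc i) = gf (\<lambda>p. ?z p \<and> size p \<le> Suc i) + fps_X * gf_size i"
  proof -
    have "gf_size (Suc i) = gf (\<lambda>p. size p \<le> Suc i \<and> ?z p) + gf (\<lambda>p. size p \<le> Suc i \<and> \<not> ?z p)"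
      by (rule gf_split)
    moreover have "gf (\<lambda>p. 1 \<le> count p 1 \<and> size p \<le> Suc i) = fps_X ^ (1 * 1) * gf_size i"
      by (rule gf_remove) auto
    ultimately show ?thesis unfolding not_z by (simp add: conj_commute)
  qed
  \<comment> \<open>For \<open>i = 0\<close> no part is allowed, hence there is no one to
    remove.\<close>
  have l: "gf_le i = gf (\<lambda>p. ?z p \<and> (\<forall>x\<in>#p. x \<le> i)) + (if i = 0 then 0 else fps_X * gf_le i)"
  proof (cases "i = 0")
    case True
    have "gf (\<lambda>p. ?z p \<and> (\<forall>x\<in>#p. x \<le> i)) = gf_le i"
      by (rule gf_cong) (use True in \<open>auto simp: count_eq_zero_iff\<close>)
    then show ?thesis using True by simp
  next
    case False
    let ?Q = "\<lambda>p. \<forall>x\<in>#p. x \<le> i"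
    have "gf_le i = gf (\<lambda>p. ?Q p \<and> ?z p) + gf (\<lambda>p. ?Q p \<and> \<not> ?z p)"
      by (rule gf_split)
    moreover have "gf (\<lambda>p. 1 \<le> count p 1 \<and> ?Q p) = fps_X ^ (1 * 1) * gf_le i"
      by (rule gf_remove) (use False in auto)
    ultimately show ?thesis unfolding not_z using False by (simp add: conj_commute)
  qed
  have i0: "i = 0 \<Longrightarrow> gf_le i = 1" using gf_le_0 by simp
  have "gf_crank i = gf (\<lambda>p. contains_rect i 2 p \<and> ?V p) + gf (\<lambda>p. ?z p \<and> size p \<le> Suc i) -
      gf (\<lambda>p. ?z p \<and> (\<forall>x\<in>#p. x \<le> i)) + (if i = 0 then fps_X else 0)"
  proof -
    have A: "gf (\<lambda>p. ?z p \<and> \<not> (\<forall>x\<in>#p. x \<le> i)) =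
        gf (\<lambda>p. ?z p \<and> contains_rect i 2 p) + gf (\<lambda>p. ?z p \<and> size p \<le> Suc i) -
        gf (\<lambda>p. ?z p \<and> (\<forall>x\<in>#p. x \<le> i))"
      by (simp only: trans[OF z2[symmetric] z1] add_diff_cancel_left')
    show ?thesis
      unfolding gf_crank_def crank K A by (simp only: algebra_simps)
  qed
  also have "\<dots> = gf (\<lambda>p. contains_rect i 2 p \<and> ?V p) + (gf_le (Suc i) - gf_le i)"
  proof -
    have "gf (\<lambda>p. ?z p \<and> size p \<le> Suc i) = gf_le (Suc i) - fps_X * gf_le i"
      using s unfolding gf_size_eq by (simp only: eq_diff_eq)
    moreover have "gf (\<lambda>p. ?z p \<and> (\<forall>x\<in>#p. x \<le> i)) =
        gf_le i - (if i = 0 then 0 else fps_X * gf_le i)"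
      using l by (simp only: eq_diff_eq)
    \<comment> \<open>For \<open>i > 0\<close> the two products \<open>fps_X * gf_le i\<close>
      cancel. For \<open>i = 0\<close> the second is absent, and the \<open>fps_X\<close> from the
      convention for \<open>n = 1\<close> cancels the first.\<close>
    ultimately show ?thesis using i0 by (cases "i = 0") simp_all
  qed
  also have "gf_le (Suc i) - gf_le i = fps_X ^ Suc i * gf_le (Suc i)"
    by (subst (1) gf_le_Suc) (simp only: add_diff_cancel_left')
  finally show ?thesis .
qed

text \<open>Since \<open>gf_le 0 = 1\<close>, the separate summand of \<open>gf_crank_eq\<close> is
  the missing term of width 1. The index \<open>e\<close> is the width minus 1.\<close>

lemma gf_crank_sum:
  "gf_crank i = (\<Sum>e<Suc N. fps_X ^ (Suc e * (Suc e + i)) * (gf_le e * gf_le (Suc e + i))) +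
    gf (\<lambda>p. contains_rect i (N + 2) p \<and> contains_rect i (Suc (count p 1)) p)"
proof -
  let ?t = "\<lambda>e. fps_X ^ (e * (e + i)) * (gf_le (e - 1) * gf_le (e + i))"
  have "(\<Sum>e<Suc N. ?t (Suc e)) = (\<Sum>e=1..<N + 2. ?t e)"
    by (simp only: sum.atLeast1_atMost_eq sum.shift_bounds_Suc_ivl lessThan_atLeast0 One_nat_def add_2_eq_Suc' sum.atLeast_Suc_lessThan_Suc_shift comp_def)
  also have "\<dots> = ?t 1 + (\<Sum>e=2..<N + 2. ?t e)"
    by (subst sum.atLeast_Suc_lessThan) (simp_all add: numeral_2_eq_2)
  also have "?t 1 = fps_X ^ Suc i * gf_le (Suc i)"
    using gf_le_0 by simp
  finally show ?thesis
    unfolding gf_crank_eq gf_rect_ones_sum[of "N + 2" i, OF le_add2]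
    by (simp only: diff_Suc_1) (simp only: add_ac)
qed

text \<open>Let t_e be the terms of Durfee's identity with offset \<open>Suc i\<close>. Up to
  remainders, \<open>gf_crank i\<close> is q^(i+1) times the sum of q^e t_e, and
  \<open>gf_crank (Suc i)\<close> is the sum of (1 - q^e) t_e, so the left side adds up to q^(i+1)
  times the sum of t_e.\<close>

lemma gf_crank_rec:
  "gf_crank i + fps_X ^ Suc i * gf_crank (Suc i) = fps_X ^ Suc i * gf (\<lambda>p. True)"
proof (rule fps_ext)
  fix n
  \<comment> \<open>All remainders then have width above \<open>n\<close>, and the sum for
    \<open>Suc i\<close> with bound \<open>n\<close> has the \<open>N\<close> terms that are left
    once the zero term \<open>e = 0\<close> is dropped.\<close>
  define N where "N = Suc n"
  let ?t = "\<lambda>e. fps_X ^ (e * (e + Suc i)) * (gf_le e * gf_le (e + Suc i))"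
  let ?K = "\<lambda>i N. gf (\<lambda>p. contains_rect i N p \<and> contains_rect i (Suc (count p 1)) p)"
  have crank1: "gf_crank i = fps_X ^ Suc i * (\<Sum>e<Suc N. fps_X ^ e * ?t e) + ?K i (N + 2)"
    unfolding gf_crank_sum[of i N] sum_distrib_left
  proof (intro arg_cong2[of _ _ _ _ "(+)"] sum.cong refl)
    fix e
    have "Suc e + i = e + Suc i" by simp
    moreover have "Suc e * (e + Suc i) = Suc i + (e + e * (e + Suc i))" by (simp add: algebra_simps)
    ultimately show "fps_X ^ (Suc e * (Suc e + i)) * (gf_le e * gf_le (Suc e + i)) =
        fps_X ^ Suc i * (fps_X ^ e * ?t e)"
      by (simp only: power_add mult.assoc)
  qed
  have "(\<Sum>e<Suc N. (1 - fps_X ^ e) * ?t e) = (\<Sum>e<N. (1 - fps_X ^ Suc e) * ?t (Suc e))"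
    by (subst sum.lessThan_Suc_shift) (simp only: power_0 diff_self mult_zero_left add_0_left)
  also have "\<dots> = (\<Sum>e<N. fps_X ^ (Suc e * (Suc e + Suc i)) * (gf_le e * gf_le (Suc e + Suc i)))"
  \<comment> \<open>The factor 1 - q^(e+1) lowers \<open>gf_le (Suc e)\<close> to
    \<open>gf_le e\<close>.\<close>
  proof (rule sum.cong[OF refl])
    fix e
    show "(1 - fps_X ^ Suc e) * ?t (Suc e) =
        fps_X ^ (Suc e * (Suc e + Suc i)) * (gf_le e * gf_le (Suc e + Suc i))"
      by (simp only: fps_solve_rec[OF gf_le_Suc[of e], symmetric] mult_ac)
  qed
  finally have crank2: "gf_crank (Suc i) = (\<Sum>e<Suc N. (1 - fps_X ^ e) * ?t e) + ?K (Suc i) (n + 2)"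
    using gf_crank_sum[of "Suc i" n] by (simp only: N_def)
  have all: "gf (\<lambda>p. True) = (\<Sum>e<Suc N. ?t e) + gf (contains_rect (Suc i) (Suc N))"
    by (rule gf_True_eq_rect_sum)
  have "x * t + (1 - x) * t = t" for x t :: "int fps"
    by (simp add: left_diff_distrib)
  then have t: "(\<Sum>e<Suc N. fps_X ^ e * ?t e) + (\<Sum>e<Suc N. (1 - fps_X ^ e) * ?t e) = (\<Sum>e<Suc N. ?t e)"
    unfolding sum.distrib[symmetric] by (intro sum.cong refl)
  have K1: "?K i (N + 2) $ n = 0"
    by (rule gf_contains_rect_nth_eq_0[where j = i and e = "N + 2"]) (auto simp: N_def)
  \<comment> \<open>All \<open>m \<le> n\<close> are needed because multiplication by
    \<open>fps_X ^ Suc i\<close> shifts the coefficient that is read off.\<close>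
  have "?K (Suc i) (n + 2) $ m = 0" "gf (contains_rect (Suc i) (Suc N)) $ m = 0" if "m \<le> n" for m
    using that by (auto simp: N_def intro: gf_contains_rect_nth_eq_0[where j = "Suc i"])
  then have K2: "(fps_X ^ Suc i * ?K (Suc i) (n + 2)) $ n = 0"
    and V: "(fps_X ^ Suc i * gf (contains_rect (Suc i) (Suc N))) $ n = 0"
    by (simp_all only: fps_X_power_mult_nth diff_le_self if_cancel)
  have "gf_crank i + fps_X ^ Suc i * gf_crank (Suc i) + fps_X ^ Suc i * gf (contains_rect (Suc i) (Suc N)) =
      fps_X ^ Suc i * gf (\<lambda>p. True) + ?K i (N + 2) + fps_X ^ Suc i * ?K (Suc i) (n + 2)"
    unfolding crank1 crank2 all t[symmetric] by (simp only: distrib_left add_ac)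
  from arg_cong[OF this, of "\<lambda>f. f $ n"]
  show "(gf_crank i + fps_X ^ Suc i * gf_crank (Suc i)) $ n = (fps_X ^ Suc i * gf (\<lambda>p. True)) $ n"
    unfolding fps_add_nth K1 K2 V add_0_right .
qed

section \<open>The generating function of the mex\<close>

lemma mex_1: "mex 1 a p = (LEAST x. a \<le> x \<and> x \<notin># p)"
  unfolding mex_def by (simp add: le_iff_add)

lemma mex_1_notin: "a \<notin># p \<Longrightarrow> mex 1 a p = a"
  unfolding mex_1 by (rule Least_equality) auto

lemma mex_1_in: "a \<in># p \<Longrightarrow> mex 1 a p = mex 1 (Suc a) p"
  unfolding mex_1 by (rule arg_cong[of _ _ Least]) (auto simp: fun_eq_iff Suc_le_eq le_less)

lemma mex_1_add: "b < a \<Longrightarrow> mex 1 a (add_mset b p) = mex 1 a p"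
  unfolding mex_1 by (rule arg_cong[of _ _ Least]) auto

text \<open>The modulus stays \<open>2 * 1\<close>, the form in which unfolding \<open>pbar\<close>
  at \<open>A = 1\<close> yields it.\<close>

lemma cong_Suc_mod_2_iff: "[a = 1 + b] (mod (2 * 1)) \<longleftrightarrow> even (a + b + 1)" for a b :: nat
  unfolding cong_def by presburger

definition gf_pbar :: "nat \<Rightarrow> int fps" where
  "gf_pbar j = gf (\<lambda>p. [mex 1 j p = 1 + j] (mod (2 * 1)))"

text \<open>The right side counts the partitions containing \<open>j\<close>, which are split by the
  parity of the mex.\<close>

lemma gf_pbar_rec:
  assumes "j > 0"
  shows "gf_pbar j + fps_X ^ j * gf_pbar (Suc j) = fps_X ^ j * gf (\<lambda>p. True)"
proof -
  let ?R = "\<lambda>j p. [mex 1 j p = 1 + j] (mod (2 * 1))"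
  have "fps_X ^ (1 * j) * gf (\<lambda>p. True) = gf (\<lambda>p. 1 \<le> count p j \<and> True)"
    by (rule gf_remove[symmetric]) (use assms in auto)
  also have "\<dots> = gf (\<lambda>p. (1 \<le> count p j \<and> True) \<and> ?R j p) +
      gf (\<lambda>p. (1 \<le> count p j \<and> True) \<and> \<not> ?R j p)"
    by (rule gf_split)
  also have "gf (\<lambda>p. (1 \<le> count p j \<and> True) \<and> ?R j p) = gf_pbar j"
    unfolding gf_pbar_def
  proof (rule gf_cong)
    fix p
    \<comment> \<open>If \<open>j\<close> is missing, the mex is \<open>j\<close> itself, of the
      wrong parity; so every partition counted by \<open>gf_pbar j\<close> contains
      \<open>j\<close>.\<close>
    have "\<not> ?R j p" if "j \<notin># p"
      unfolding cong_Suc_mod_2_iff mex_1_notin[OF that] by simp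
    then show "(1 \<le> count p j \<and> True) \<and> ?R j p \<longleftrightarrow> ?R j p"
      by (auto simp: Suc_le_eq)
  qed
  also have "gf (\<lambda>p. (1 \<le> count p j \<and> True) \<and> \<not> ?R j p) = fps_X ^ (1 * j) * gf_pbar (Suc j)"
    unfolding gf_pbar_def simp_thms
  proof (rule gf_remove[OF assms])
    fix p
    \<comment> \<open>The mex keeps its value when \<open>j\<close> is removed and the start moves
      to \<open>Suc j\<close>, while the required parity flips.\<close>
    have "mex 1 j (add_mset j p) = mex 1 (Suc j) p"
      using mex_1_in[of j "add_mset j p"] mex_1_add[of j "Suc j" p] by simp
    then show "\<not> ?R j (p + replicate_mset 1 j) \<longleftrightarrow> ?R (Suc j) p"
      unfolding cong_Suc_mod_2_iff by simp
  qed
  finally show ?thesis by simp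
qed

section \<open>Comparison of mex and crank\<close>

text \<open>In the common recurrence the factor q^(i+1) lowers the coefficient index, so strong
  induction on \<open>n\<close> applies; \<open>i\<close> is arbitrary because the recurrence passes
  to \<open>Suc i\<close>.\<close>

lemma gf_pbar_eq_gf_crank: "gf_pbar (Suc i) $ n = gf_crank i $ n"
proof (induction n arbitrary: i rule: less_induct)
  case (less n)
  have "(gf_pbar (Suc i) + fps_X ^ Suc i * gf_pbar (Suc (Suc i))) $ n =
      (gf_crank i + fps_X ^ Suc i * gf_crank (Suc i)) $ n"
    by (simp only: gf_pbar_rec[OF zero_less_Suc] gf_crank_rec)
  moreover have "(fps_X ^ Suc i * gf_pbar (Suc (Suc i))) $ n = (fps_X ^ Suc i * gf_crank (Suc i)) $ n"
    using less[of "n - Suc i" "Suc i"] by (simp only: fps_X_power_mult_nth) simp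
  ultimately show ?case by (simp only: fps_add_nth add_right_cancel)
qed

text \<open>For \<open>n = 1\<close> the only partition has crank -1, and M(1,1) = 1 is matched by
  the extra \<open>fps_X\<close>. Otherwise the partitions are grouped by their crank.\<close>

lemma sum_crank_count:
  assumes "n > 0"
  shows "(\<Sum>m | int (Suc i) \<le> m \<and> crank_count m n \<noteq> 0. crank_count m n) = gf_crank i $ n"
proof (cases "n = 1")
  case True
  have "p = {#1#}" if p: "p \<in> partitions_of 1" for p
  proof -
    obtain x q where q: "p = add_mset x q" using p by (cases p) (auto simp: partitions_of_def)
    then have "x + sum_mset q = 1" "x \<noteq> 0" and q0: "0 \<notin># q"
      using p by (auto simp: partitions_of_def)
    then have "x = 1" "sum_mset q = 0" by linarith+
    then have "q = {#}" using q0 by (cases q) auto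
    with q \<open>x = 1\<close> show ?thesis by simp
  qed
  moreover have "crank {#1#} = - 1" by (simp add: crank_def)
  ultimately have "{p \<in> partitions_of 1. int (Suc i) \<le> crank p} = {}" by fastforce
  then have "gf_crank i $ 1 = (if i = 0 then 1 else 0)"
    by (simp only: gf_crank_def fps_add_nth gf_nth card.empty of_nat_0) simp
  moreover have "{m. int (Suc i) \<le> m \<and> crank_count m 1 \<noteq> 0} = (if i = 0 then {1} else {})"
    by (auto simp: crank_count_def split: if_splits)
  ultimately show ?thesis using True by (simp add: crank_count_def)
next
  case False
  let ?S = "{m. int (Suc i) \<le> m \<and> crank_count m n \<noteq> 0}"
  let ?F = "\<lambda>m. {p \<in> partitions_of n. crank p = m}"
  have fin: "finite ?S" by (rule finite_subset[OF _ finite_crank_count_support[of n]]) auto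
  have "{p \<in> partitions_of n. int (Suc i) \<le> crank p} = (\<Union>m\<in>?S. ?F m)"
    using False by (auto simp: crank_count_def finite_partitions_of)
  also have "card \<dots> = (\<Sum>m\<in>?S. card (?F m))"
    by (rule card_UN_disjoint) (use fin in \<open>auto simp: finite_partitions_of\<close>)
  finally show ?thesis
    using False by (simp add: crank_count_def gf_crank_def gf_nth)
qed

theorem theorem3p6:
  fixes j n :: nat
  assumes "j > 0" and "n > 0"
  shows "int (pbar 1 j n) = (\<Sum>m | int j \<le> m \<and> crank_count m n \<noteq> 0. crank_count m n)"
proof -
  obtain i where i: "j = Suc i" using assms(1) gr0_implies_Suc by blast
  have "int (pbar 1 j n) = gf_pbar j $ n"
    by (simp only: pbar_def gf_pbar_def gf_nth)
  then show ?thesis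
    using sum_crank_count[OF assms(2), of i] gf_pbar_eq_gf_crank[of i n] i by simp
qed

end
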